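(* Let $s\in\mathbb{C}$ with $|\mathrm{Re}(s)|<1$. Then $$\int_{0}^{1}\frac{r^{2s+1}}{(1-r^2)^{s}}\,dr=\frac{\Gamma(1+s)\,\Gamma(1-s)}{2}.$$
   Context: $\Gamma$ is Euler's Gamma function, and powers of positive real numbers are $x^{s}=e^{s\ln x}$. *)

theory Defs
  imports "HOL-Analysis.Analysis"
begin

end

theory Submission
  imports Defs "HOL-Real_Asymp.Real_Asymp"
begin

text \<open>Write \<open>\<Gamma>(a + b) / (1 + v)\<^sup>a\<^sup>+\<^sup>b\<close> as the Gamma integral of \<open>y\<^sup>a\<^sup>+\<^sup>b\<^sup>-\<^sup>1 exp (- (1 + v) y)\<close> and exchange
  the order of integration: this evaluates the complex Beta integral of
  \<open>v\<^sup>a\<^sup>-\<^sup>1 / (1 + v)\<^sup>a\<^sup>+\<^sup>b\<close> over \<open>v > 0\<close>. The theorem is the case \<open>a = 1 + s\<close>, \<open>b = 1 - s\<close> after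
  the substitution \<open>v = r\<^sup>2 / (1 - r\<^sup>2)\<close>.\<close>

text \<open>On the real axis the principal logarithm is \<open>ln \<bar>t\<bar>\<close>, plus
  \<open>\<i> * pi\<close> for negative \<open>t\<close>, so the power is a case split between
  measurable expressions, with value 0 at \<open>t = 0\<close>.\<close>

lemma borel_measurable_of_real_powr [measurable]:
  assumes [measurable]: "f \<in> borel_measurable M"
  shows "(\<lambda>x. complex_of_real (f x) powr w) \<in> borel_measurable M"
proof -
  have "complex_of_real t powr w = (if t = 0 then 0
      else exp (w * (of_real (ln \<bar>t\<bar>) + of_real (if t < 0 then pi else 0) * \<i>)))" for t
    by (simp add: powr_def Ln_of_real')
  then show ?thesis
    by simp
qed

text \<open>The Gamma integrand with rate \<open>c\<close>, extended by zero to the whole line so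
  that Fubini applies over \<open>lborel\<close>. The rate is a parameter because the other
  integration variable enters through it.\<close>

definition Gamma_kernel :: "complex \<Rightarrow> real \<Rightarrow> real \<Rightarrow> complex" where
  "Gamma_kernel z c t =
     indicator {0<..} t *\<^sub>R (complex_of_real t powr (z - 1) * of_real (exp (- (c * t))))"

lemma borel_measurable_Gamma_kernel [measurable]:
  assumes [measurable]: "f \<in> borel_measurable M" "g \<in> borel_measurable M"
  shows "(\<lambda>x. Gamma_kernel z (f x) (g x)) \<in> borel_measurable M"
  unfolding Gamma_kernel_def by measurable

text \<open>Makes the integral of the norm a Gamma integral again; the embedding into the complex
  numbers keeps the kernel on both sides.\<close>

lemma norm_Gamma_kernel:
  "complex_of_real (norm (Gamma_kernel z c t)) = Gamma_kernel (of_real (Re z)) c t"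
proof (cases "t > 0")
  case True
  then have "complex_of_real t powr (complex_of_real (Re z) - 1) = of_real (t powr (Re z - 1))"
    using powr_of_real[of t "Re z - 1"] by simp
  with True show ?thesis
    by (simp add: Gamma_kernel_def norm_mult norm_powr_real_powr)
qed (simp add: Gamma_kernel_def)

text \<open>Rescaling \<open>t\<close> to \<open>c * t\<close> reduces to rate 1: the Jacobian
  \<open>1 / c\<close> and the factor \<open>c powr (1 - z)\<close> combine to
  \<open>1 / c powr z\<close>.\<close>

lemma has_bochner_integral_Gamma_kernel:
  assumes "Re z > 0" "c > 0"
  shows "has_bochner_integral lborel (Gamma_kernel z c) (Gamma z / of_real c powr z)"
proof -
  have eq: "Gamma_kernel z 1 = (\<lambda>t. indicator {0<..} t *\<^sub>R (of_real t powr (z - 1) / of_real (exp t)))"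
    by (auto simp: Gamma_kernel_def exp_minus field_simps)
  have int: "integrable lborel (Gamma_kernel z 1)"
  proof -
    \<comment> \<open>Absolute integrability refers to Lebesgue measure; Borel measurability of the
      kernel brings it down to \<open>lborel\<close>.\<close>
    have "integrable (completion lborel) (Gamma_kernel z 1)"
      using absolutely_integrable_Gamma_integral'[OF assms(1)] unfolding eq set_integrable_def .
    then show ?thesis
      by (subst (asm) integrable_completion) auto
  qed
  have "has_bochner_integral lborel (Gamma_kernel z 1) (Gamma z)"
  proof -
    have "integral\<^sup>L lborel (Gamma_kernel z 1) =
        integral {0<..} (\<lambda>t. of_real t powr (z - 1) / of_real (exp t))"
      using set_borel_integral_eq_integral(2)[of "{0<..}" "\<lambda>t. of_real t powr (z - 1) / of_real (exp t)"] int
      unfolding eq set_integrable_def set_lebesgue_integral_def by simp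
    with Gamma_integral_complex'[OF assms(1)] int show ?thesis
      by (simp add: has_bochner_integral_iff integral_unique)
  qed
  then have "has_bochner_integral lborel (\<lambda>t. Gamma_kernel z 1 (0 + c * t)) (Gamma z /\<^sub>R \<bar>c\<bar>)"
    using assms(2) by (subst (asm) lborel_has_bochner_integral_real_affine_iff[where c = c and t = 0]) auto
  then have "has_bochner_integral lborel
      (\<lambda>t. of_real c powr (1 - z) * Gamma_kernel z 1 (0 + c * t)) (of_real c powr (1 - z) * (Gamma z /\<^sub>R \<bar>c\<bar>))"
    by (intro has_bochner_integral_mult_right) auto
  also have "(\<lambda>t. of_real c powr (1 - z) * Gamma_kernel z 1 (0 + c * t)) = Gamma_kernel z c"
  proof
    fix t
    have "of_real c powr (1 - z) * (of_real (c * t) powr (z - 1)) = complex_of_real t powr (z - 1)" if "t > 0"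
    proof -
      have "of_real (c * t) powr (z - 1) = of_real c powr (z - 1) * complex_of_real t powr (z - 1)"
        using assms(2) that by (simp add: powr_times_real)
      moreover have "of_real c powr (1 - z) * of_real c powr (z - 1) = (1 :: complex)"
        using assms(2) by (simp flip: powr_add)
      ultimately show ?thesis
        by (simp flip: mult.assoc)
    qed
    then show "of_real c powr (1 - z) * Gamma_kernel z 1 (0 + c * t) = Gamma_kernel z c t"
      using assms(2) by (auto simp: Gamma_kernel_def zero_less_mult_iff indicator_def simp flip: mult.assoc)
  qed
  also have "of_real c powr (1 - z) * (Gamma z /\<^sub>R \<bar>c\<bar>) = Gamma z / of_real c powr z"
    using assms(2) by (simp add: powr_diff scaleR_conv_of_real field_simps)
  finally show ?thesis .
qed

text \<open>The power of \<open>c\<close> stays complex under the norm, so that in the Fubini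
  argument it can be absorbed into the outer kernel.\<close>

lemma integral_norm_Gamma_kernel:
  assumes "Re z > 0" "c > 0"
  shows "(\<integral>t. norm (Gamma_kernel z c t) \<partial>lborel) = norm (Gamma (complex_of_real (Re z)) / of_real c powr z)"
proof -
  have "complex_of_real (\<integral>t. norm (Gamma_kernel z c t) \<partial>lborel) =
      (\<integral>t. Gamma_kernel (of_real (Re z)) c t \<partial>lborel)"
    by (simp add: norm_Gamma_kernel flip: integral_complex_of_real)
  also have "\<dots> = Gamma (of_real (Re z)) / of_real c powr of_real (Re z)"
    using has_bochner_integral_Gamma_kernel[of "of_real (Re z)" c] assms
    by (simp add: has_bochner_integral_iff)
  finally have "norm (complex_of_real (\<integral>t. norm (Gamma_kernel z c t) \<partial>lborel)) =
      norm (Gamma (complex_of_real (Re z)) / of_real c powr z)"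
    using assms(2) by (simp add: norm_divide norm_powr_real_powr)
  then show ?thesis by simp
qed

lemma has_bochner_integral_Beta_complex:
  fixes a b :: complex
  assumes a: "Re a > 0" and b: "Re b > 0"
  shows "has_bochner_integral lborel
     (\<lambda>v. indicator {0<..} v *\<^sub>R (complex_of_real v powr (a - 1) / of_real (1 + v) powr (a + b)))
     (Beta a b)"
proof -
  have ab: "Re (a + b) > 0" using a b by simp
  define w where "w = (\<lambda>v. indicator {0<..} v *\<^sub>R
    (complex_of_real v powr (a - 1) / of_real (1 + v) powr (a + b)))"
  \<comment> \<open>Integrating over \<open>v\<close> first will give
    \<open>Gamma a * Gamma b\<close>; integrating over \<open>y\<close> first will give
    \<open>Gamma (a + b)\<close> times the integral of \<open>w\<close>.\<close>
  define F where "F = (\<lambda>(y, v). Gamma_kernel (a + b) 1 y * Gamma_kernel a y v)"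
  have shift: "Gamma_kernel (a + b) 1 y / of_real y powr a = Gamma_kernel b 1 y" for y
    by (cases "y > 0") (auto simp: Gamma_kernel_def powr_add powr_diff field_simps)
  have inner: "has_bochner_integral lborel (\<lambda>v. F (y, v)) (Gamma a * Gamma_kernel b 1 y)" for y
  proof (cases "y > 0")
    case True
    have "has_bochner_integral lborel (\<lambda>v. F (y, v)) (Gamma_kernel (a + b) 1 y * (Gamma a / of_real y powr a))"
      unfolding F_def prod.case
      by (intro has_bochner_integral_mult_right has_bochner_integral_Gamma_kernel a True)
    then show ?thesis
      by (simp add: mult_ac flip: shift)
  qed (simp add: F_def Gamma_kernel_def has_bochner_integral_iff)
  have int: "integrable (lborel \<Otimes>\<^sub>M lborel) F"
  proof (rule lborel_pair.Fubini_integrable)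
    show "F \<in> borel_measurable (lborel \<Otimes>\<^sub>M lborel)"
      unfolding F_def by measurable
    \<comment> \<open>The inner integral of the norm leaves a constant multiple of the norm of the
      kernel for \<open>b\<close>, which is integrable.\<close>
    have "(\<lambda>y. \<integral>v. norm (F (y, v)) \<partial>lborel) =
        (\<lambda>y. norm (Gamma (complex_of_real (Re a))) * norm (Gamma_kernel b 1 y))"
    proof
      fix y
      show "(\<integral>v. norm (F (y, v)) \<partial>lborel) =
        norm (Gamma (complex_of_real (Re a))) * norm (Gamma_kernel b 1 y)"
      proof (cases "y > 0")
        case True
        then show ?thesis
          using a by (simp add: F_def norm_mult integral_norm_Gamma_kernel norm_divide flip: shift)
      qed (simp add: F_def Gamma_kernel_def)
    qed
    moreover have "integrable lborel (Gamma_kernel b 1)"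
      using has_bochner_integral_Gamma_kernel[OF b zero_less_one] by (simp add: has_bochner_integral_iff)
    ultimately show "integrable lborel (\<lambda>y. \<integral>v. norm (F (y, v)) \<partial>lborel)"
      by simp
    show "AE y in lborel. integrable lborel (\<lambda>v. F (y, v))"
      using inner by (simp add: has_bochner_integral_iff)
  qed
  have outer: "(\<integral>y. F (y, v) \<partial>lborel) = Gamma (a + b) * w v" for v
  proof (cases "v > 0")
    case True
    \<comment> \<open>The two exponentials merge, so in \<open>y\<close> this is a Gamma kernel of
      rate \<open>1 + v\<close>.\<close>
    have "F (y, v) = of_real v powr (a - 1) * Gamma_kernel (a + b) (1 + v) y" for y
    proof -
      have "exp (- ((1 + v) * y)) = exp (- y) * exp (- (y * v))"
        by (simp add: algebra_simps flip: exp_add)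
      then show ?thesis
        using True by (simp add: F_def Gamma_kernel_def)
    qed
    moreover have "has_bochner_integral lborel (Gamma_kernel (a + b) (1 + v))
        (Gamma (a + b) / of_real (1 + v) powr (a + b))"
      by (rule has_bochner_integral_Gamma_kernel[OF ab]) (use True in simp)
    ultimately show ?thesis
      using True by (simp add: w_def has_bochner_integral_iff)
  qed (simp add: F_def w_def Gamma_kernel_def)
  \<comment> \<open>\<open>Gamma\<close> takes the value 0 only at its poles, by convention, and
    these have real part at most 0.\<close>
  have nz: "Gamma (a + b) \<noteq> 0"
    using ab
    by (auto simp: Gamma_eq_zero_iff simp del: plus_complex.sel elim!: nonpos_Ints_cases)
  have "integrable lborel (\<lambda>v. \<integral>y. F (y, v) \<partial>lborel)"
    by (rule lborel_pair.integrable_snd) (use int in \<open>simp add: case_prod_beta'\<close>)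
  then have "integrable lborel (\<lambda>v. inverse (Gamma (a + b)) * (\<integral>y. F (y, v) \<partial>lborel))"
    by (intro integrable_mult_right) auto
  then have "integrable lborel w"
    unfolding outer mult.assoc[symmetric] using nz by simp
  moreover have "(\<integral>v. (\<integral>y. F (y, v) \<partial>lborel) \<partial>lborel) = (\<integral>y. (\<integral>v. F (y, v) \<partial>lborel) \<partial>lborel)"
    by (rule lborel_pair.Fubini_integral) (use int in \<open>simp add: case_prod_beta'\<close>)
  then have "Gamma (a + b) * integral\<^sup>L lborel w = Gamma a * Gamma b"
    using has_bochner_integral_Gamma_kernel[OF b zero_less_one] inner
    unfolding outer by (simp add: has_bochner_integral_iff)
  ultimately show ?thesis
    using nz unfolding w_def[symmetric]
    by (simp add: has_bochner_integral_iff Beta_def field_simps)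
qed

text \<open>Factor \<open>1 - r\<^sup>2\<close> as \<open>(1 - r) * (1 + r)\<close>. Since
  \<open>- Re s < 1\<close>, the power of \<open>1 + r\<close> is at most 2, so twice a real Beta
  integrand dominates; its parameters \<open>2 * Re s + 2\<close> and \<open>1 - Re s\<close> are
  positive.\<close>

lemma set_integrable_powr_over_powr:
  fixes s :: complex
  assumes "\<bar>Re s\<bar> < 1"
  shows "set_integrable lborel {0<..<1::real}
     (\<lambda>r. complex_of_real r powr (2 * s + 1) / complex_of_real (1 - r\<^sup>2) powr s)"
  unfolding set_integrable_def
proof (rule Bochner_Integration.integrable_bound[OF _ _ AE_I2])
  show "integrable lborel (\<lambda>r. 2 * (indicator {0..1} r *\<^sub>R
      (r powr ((2 * Re s + 2) - 1) * (1 - r) powr ((1 - Re s) - 1))))"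
    using integrable_Beta[of "2 * Re s + 2" "1 - Re s"] assms
    unfolding set_integrable_def by (intro integrable_mult_right) auto
  fix r :: real
  show "norm (indicator {0<..<1} r *\<^sub>R
        (complex_of_real r powr (2 * s + 1) / complex_of_real (1 - r\<^sup>2) powr s))
      \<le> norm (2 * (indicator {0..1} r *\<^sub>R
        (r powr ((2 * Re s + 2) - 1) * (1 - r) powr ((1 - Re s) - 1))))"
  proof (cases "r \<in> {0<..<1}")
    case True
    then have r: "0 < r" "r < 1" by auto
    then have r2: "1 - r\<^sup>2 > 0" by (simp add: abs_square_less_1)
    have "(1 + r) powr (- Re s) \<le> (1 + r) powr 1"
      using r assms by (intro powr_mono) auto
    also have "\<dots> \<le> 2" using r by simp
    finally have *: "(1 + r) powr (- Re s) \<le> 2" .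
    have "(1 - r\<^sup>2) powr (- Re s) = (1 - r) powr (- Re s) * (1 + r) powr (- Re s)"
      using r by (simp add: power2_eq_square algebra_simps flip: powr_mult)
    also have "\<dots> \<le> (1 - r) powr (- Re s) * 2"
      using * by (intro mult_left_mono) auto
    finally have "(1 - r\<^sup>2) powr (- Re s) \<le> 2 * (1 - r) powr (- Re s)" by simp
    then have "r powr (2 * Re s + 1) * (1 - r\<^sup>2) powr (- Re s)
        \<le> r powr (2 * Re s + 1) * (2 * (1 - r) powr (- Re s))"
      by (intro mult_left_mono) auto
    moreover have "norm (complex_of_real r powr (2 * s + 1) / complex_of_real (1 - r\<^sup>2) powr s) =
        r powr (2 * Re s + 1) * (1 - r\<^sup>2) powr (- Re s)"
      using r r2 by (simp add: norm_mult norm_inverse norm_powr_real_powr powr_minus divide_inverse del: of_real_diff of_real_power)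
    ultimately show ?thesis
      using r by (simp add: abs_mult mult_ac add_ac)
  qed simp
qed measurable

theorem theorem3:
  fixes s :: complex
  assumes "\<bar>Re s\<bar> < 1"
  shows "set_integrable lborel {0<..<1::real}
           (\<lambda>r. complex_of_real r powr (2 * s + 1) / complex_of_real (1 - r\<^sup>2) powr s)
       \<and> (LBINT r:{0<..<1::real}. complex_of_real r powr (2 * s + 1) / complex_of_real (1 - r\<^sup>2) powr s)
           = Gamma (1 + s) * Gamma (1 - s) / 2"
proof -
  define h where "h = (\<lambda>r. complex_of_real r powr (2 * s + 1) / complex_of_real (1 - r\<^sup>2) powr s)"
  define f where "f = (\<lambda>v. complex_of_real v powr s / of_real (1 + v) powr 2)"
  define g :: "real \<Rightarrow> real" where "g = (\<lambda>r. r\<^sup>2 / (1 - r\<^sup>2))"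
  define g' :: "real \<Rightarrow> real" where "g' = (\<lambda>r. 2 * r / (1 - r\<^sup>2)\<^sup>2)"
  have h_int: "set_integrable lborel {0<..<1} h"
    unfolding h_def by (rule set_integrable_powr_over_powr[OF assms])
  \<comment> \<open>Here \<open>a + b = 2\<close> and \<open>Gamma 2 = 1\<close>, so the denominator
    of \<open>Beta\<close> disappears.\<close>
  have beta: "has_bochner_integral lborel (\<lambda>v. indicator {0<..} v *\<^sub>R f v) (Gamma (1 + s) * Gamma (1 - s))"
    using has_bochner_integral_Beta_complex[of "1 + s" "1 - s"] assms
    by (simp add: f_def Beta_def Gamma_numeral)
  have sq: "1 - r\<^sup>2 > 0" if "0 < r" "r < 1" for r :: real
    using that by (simp add: abs_square_less_1)
  have g_pos: "g r > 0" if "0 < r" "r < 1" for r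
    using sq[OF that] that by (simp add: g_def)
  \<comment> \<open>The factor 2 from \<open>g'\<close> becomes the final division by 2. All bases
    are positive reals, so the logarithms split without branch corrections.\<close>
  have subst: "g' r *\<^sub>R f (g r) = 2 * h r" if r: "0 < r" "r < 1" for r
  proof -
    have "1 + g r = inverse (1 - r\<^sup>2)"
      using sq[OF r] by (simp add: g_def field_simps)
    then have "complex_of_real (1 + g r) powr 2 = of_real (inverse (1 - r\<^sup>2) ^ 2)"
      using sq[OF r] by (simp add: powr_numeral del: of_real_diff)
    moreover have "complex_of_real (g r) powr s = of_real r powr (2 * s) / of_real (1 - r\<^sup>2) powr s"
    proof -
      have "complex_of_real (ln (g r)) = 2 * of_real (ln r) - of_real (ln (1 - r\<^sup>2))"
        using r sq[OF r] by (simp add: g_def ln_div ln_realpow)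
      then show ?thesis
        using r sq[OF r] g_pos[OF r]
        by (simp add: powr_def Ln_of_real right_diff_distrib mult_ac del: of_real_diff of_real_power flip: exp_diff)
    qed
    moreover have "complex_of_real (g' r) / of_real (inverse (1 - r\<^sup>2) ^ 2) = 2 * of_real r"
    proof -
      have "g' r / inverse (1 - r\<^sup>2) ^ 2 = 2 * r"
        using sq[OF r] by (simp add: g'_def field_simps)
      then show ?thesis
        by (metis of_real_divide of_real_mult of_real_numeral)
    qed
    moreover have "h r = of_real r * of_real r powr (2 * s) / of_real (1 - r\<^sup>2) powr s"
      using r by (simp add: h_def powr_add mult.commute)
    moreover have "g' r *\<^sub>R f (g r) =
        (complex_of_real (g' r) / of_real (1 + g r) powr 2) * of_real (g r) powr s"
      by (simp add: f_def scaleR_conv_of_real)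
    ultimately show ?thesis
      by (simp del: of_real_diff of_real_add)
  qed
  have "(LBINT v=0..\<infinity>. f v) = (LBINT r=0..1. g' r *\<^sub>R f (g r))"
  \<comment> \<open>As \<open>f\<close> is complex valued, positivity cannot supply integrability;
    it comes from \<open>h_int\<close> on the \<open>r\<close> side and from \<open>beta\<close> on
    the \<open>v\<close> side.\<close>
  proof (rule interval_integral_substitution_integrable)
    fix r :: real assume "0 < ereal r" "ereal r < 1"
    then have r: "0 < r" "r < 1" by (auto simp: zero_ereal_def one_ereal_def)
    show "DERIV g r :> g' r"
      unfolding g_def g'_def using sq[OF r]
      by (auto intro!: derivative_eq_intros simp: power2_eq_square field_simps)
    show "isCont f (g r)"
      unfolding f_def using g_pos[OF r]
      by (intro continuous_intros) (auto simp: complex_nonpos_Reals_iff complex_eq_iff)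
    show "isCont g' r"
      unfolding g'_def using sq[OF r] by (intro continuous_intros) auto
  next
    fix r :: real assume "0 \<le> ereal r" "ereal r \<le> 1"
    \<comment> \<open>The endpoint \<open>r = 1\<close> is included: there division by zero makes
      \<open>g'\<close> equal to 0.\<close>
    then show "0 \<le> g' r" by (auto simp: g'_def zero_ereal_def)
  next
    have "(g \<longlongrightarrow> 0) (at_right 0)"
      unfolding g_def by real_asymp
    then show "((ereal \<circ> g \<circ> real_of_ereal) \<longlongrightarrow> 0) (at_right 0)"
      by (simp add: zero_ereal_def ereal_tendsto_simps)
    have "filterlim g at_top (at_left 1)"
      unfolding g_def by real_asymp
    then show "((ereal \<circ> g \<circ> real_of_ereal) \<longlongrightarrow> \<infinity>) (at_left 1)"
      by (simp add: one_ereal_def ereal_tendsto_simps)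
  next
    have "set_integrable lborel {0<..<1} (\<lambda>r. 2 * h r)"
      using h_int by simp
    then have "set_integrable lborel {0<..<1} (\<lambda>r. g' r *\<^sub>R f (g r))"
      by (rule set_integrable_cong[THEN iffD1, rotated -1]) (auto simp: subst)
    then show "set_integrable lborel (einterval 0 1) (\<lambda>r. g' r *\<^sub>R f (g r))"
      by (simp add: zero_ereal_def one_ereal_def)
    show "set_integrable lborel (einterval 0 \<infinity>) f"
      using beta by (simp add: zero_ereal_def set_integrable_def has_bochner_integral_iff)
  qed simp
  also have "(LBINT v=0..\<infinity>. f v) = Gamma (1 + s) * Gamma (1 - s)"
    using beta by (simp add: zero_ereal_def interval_integral_to_infinity_eq set_lebesgue_integral_def
        has_bochner_integral_iff)
  also have "(LBINT r=0..1. g' r *\<^sub>R f (g r)) = (LBINT r:{0<..<1}. g' r *\<^sub>R f (g r))"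
    by (simp add: interval_lebesgue_integral_le_eq zero_ereal_def one_ereal_def)
  also have "\<dots> = (LBINT r:{0<..<1}. 2 * h r)"
    by (rule set_lebesgue_integral_cong) (auto simp: subst)
  finally have "(LBINT r:{0<..<1}. h r) = Gamma (1 + s) * Gamma (1 - s) / 2"
    by simp
  with h_int show ?thesis
    unfolding h_def by blast
qed

end
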